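(* There is no connected ordered $\lambda$-model with more than one element that satisfies both equations $\Theta x x = \Omega$ and $\Theta x\Omega = x$.
   Context: $\Omega \equiv (\lambda x.xx)(\lambda x.xx)$, $B \equiv \lambda x.x(\lambda y.yx)$, $C \equiv \lambda z.zB$, $\Theta \equiv BC$. A combinatory algebra is a structure $(A,\cdot,K,S)$ with a binary application satisfying $Kxy=x$, $Sxyz=xz(yz)$. With $I\equiv SKK$, $\varepsilon\equiv\varepsilon_1 \equiv S(KI)$, $\varepsilon_{n+1}\equiv S(K\varepsilon)(S(K\varepsilon_n))$, a $\lambda$-model is a combinatory algebra satisfying $\forall xy((\forall z.\ xz=yz)\Rightarrow\varepsilon x=\varepsilon y)$, $\varepsilon_2K=K$, $\varepsilon_3S=S$; $\lambda$-terms are interpreted in the standard way and an equation holds if both sides have equal interpretation in every environment. An ordered $\lambda$-model is a $\lambda$-model with a partial order $\le$ making application monotone in both arguments. It is connected if the least equivalence relation containing $\le$ has a single equivalence class. *)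

theory Defs
  imports Main
begin

type_synonym vname = string

datatype lterm = Var vname | App lterm lterm | Lam vname lterm

definition Omega_tm :: lterm where
  "Omega_tm =
     App (Lam ''x'' (App (Var ''x'') (Var ''x''))) (Lam ''x'' (App (Var ''x'') (Var ''x'')))"

definition B_tm :: lterm where
  "B_tm = Lam ''x'' (App (Var ''x'') (Lam ''y'' (App (Var ''y'') (Var ''x''))))"

definition C_tm :: lterm where
  "C_tm = Lam ''z'' (App (Var ''z'') B_tm)"

definition Theta_tm :: lterm where
  "Theta_tm = App B_tm C_tm"

datatype cterm = CVar vname | CK | CS | CApp cterm cterm

primrec cfv :: "cterm \<Rightarrow> vname set" where
  "cfv (CVar y) = {y}"
| "cfv CK = {}"
| "cfv CS = {}"
| "cfv (CApp P Q) = cfv P \<union> cfv Q"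

text \<open>
  Bracket abstraction and the induced translation of lambda terms into combinatory terms, with the
  usual clauses: $\lambda^* x.x = SKK$; $\lambda^* x.P = KP$ if $x$ is not free in $P$;
  $\lambda^* x.PQ = S(\lambda^* x.P)(\lambda^* x.Q)$ otherwise. The interpretation of a lambda term
  in a lambda model is the value of its translation.
\<close>

fun cabs :: "vname \<Rightarrow> cterm \<Rightarrow> cterm" where
  "cabs x (CVar y) = (if x = y then CApp (CApp CS CK) CK else CApp CK (CVar y))"
| "cabs x CK = CApp CK CK"
| "cabs x CS = CApp CK CS"
| "cabs x (CApp P Q) =
     (if x \<notin> cfv (CApp P Q) then CApp CK (CApp P Q)
      else CApp (CApp CS (cabs x P)) (cabs x Q))"

primrec translate :: "lterm \<Rightarrow> cterm" where
  "translate (Var x) = CVar x"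
| "translate (App M N) = CApp (translate M) (translate N)"
| "translate (Lam x M) = cabs x (translate M)"

locale combinatory_algebra =
  fixes app :: "'a \<Rightarrow> 'a \<Rightarrow> 'a"  (infixl "\<cdot>" 70)
    and K :: 'a
    and S :: 'a
  assumes K_app: "K \<cdot> x \<cdot> y = x"
    and S_app: "S \<cdot> x \<cdot> y \<cdot> z = x \<cdot> z \<cdot> (y \<cdot> z)"
begin

definition I :: 'a where
  "I = S \<cdot> K \<cdot> K"

text \<open>The index starts at 1; \<open>eps 0\<close> is unspecified and never used.\<close>

fun eps :: "nat \<Rightarrow> 'a" where
  "eps (Suc 0) = S \<cdot> (K \<cdot> I)"
| "eps (Suc (Suc n)) = S \<cdot> (K \<cdot> eps (Suc 0)) \<cdot> (S \<cdot> (K \<cdot> eps (Suc n)))"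

primrec ceval :: "(vname \<Rightarrow> 'a) \<Rightarrow> cterm \<Rightarrow> 'a" where
  "ceval \<rho> (CVar x) = \<rho> x"
| "ceval \<rho> CK = K"
| "ceval \<rho> CS = S"
| "ceval \<rho> (CApp P Q) = ceval \<rho> P \<cdot> ceval \<rho> Q"

definition interp :: "(vname \<Rightarrow> 'a) \<Rightarrow> lterm \<Rightarrow> 'a" where
  "interp \<rho> M = ceval \<rho> (translate M)"

definition satisfies_eq :: "lterm \<Rightarrow> lterm \<Rightarrow> bool" where
  "satisfies_eq M N \<longleftrightarrow> (\<forall>\<rho>. interp \<rho> M = interp \<rho> N)"

end

locale lambda_model = combinatory_algebra +
  assumes weak_ext: "(\<And>z. x \<cdot> z = y \<cdot> z) \<Longrightarrow> eps 1 \<cdot> x = eps 1 \<cdot> y"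
    and eps2_K: "eps 2 \<cdot> K = K"
    and eps3_S: "eps 3 \<cdot> S = S"

locale ordered_lambda_model = lambda_model +
  fixes le :: "'a \<Rightarrow> 'a \<Rightarrow> bool"
  assumes le_refl: "reflp le"
    and le_trans: "transp le"
    and le_antisym: "antisymp le"
    and app_mono_left: "le x x' \<Longrightarrow> le (x \<cdot> y) (x' \<cdot> y)"
    and app_mono_right: "le y y' \<Longrightarrow> le (x \<cdot> y) (x \<cdot> y')"

locale connected_ordered_lambda_model = ordered_lambda_model +
  assumes connected: "is_singleton (UNIV // {(x, y). equivclp le x y})"

end

theory Submission
  imports Defs
begin

text \<open>
  If \<open>x\<close> and \<open>y\<close> are comparable, then \<open>\<Theta>xy\<close> lies between \<open>\<Theta>xx = \<Omega>\<close> and \<open>\<Theta>yy = \<Omega>\<close> by monotonicity, so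
  \<open>\<Theta>xy = \<Omega>\<close>. Taking \<open>y = \<Omega>\<close> gives \<open>x = \<Theta>x\<Omega> = \<Omega>\<close>: the element \<open>\<Omega>\<close> is comparable only with itself
  and hence is a connected component on its own.
\<close>

context ordered_lambda_model
begin

lemma subtraction_comparable_eq:
  assumes diag: "\<And>x. t \<cdot> x \<cdot> x = z"
    and comparable: "le x y \<or> le y x"
  shows "t \<cdot> x \<cdot> y = z"
proof -
  \<comment> \<open>Both argument orders are settled together, so that either direction of
    comparability is covered by exchanging \<open>a\<close> and \<open>b\<close>.\<close>
  have "t \<cdot> a \<cdot> b = z \<and> t \<cdot> b \<cdot> a = z" if "le a b" for a b
  proof -
    have "le (t \<cdot> a \<cdot> a) (t \<cdot> a \<cdot> b)" "le (t \<cdot> a \<cdot> b) (t \<cdot> b \<cdot> b)"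
      "le (t \<cdot> a \<cdot> a) (t \<cdot> b \<cdot> a)" "le (t \<cdot> b \<cdot> a) (t \<cdot> b \<cdot> b)"
      using that by (simp_all add: app_mono_left app_mono_right)
    then show ?thesis
      by (auto simp: diag intro: antisympD[OF le_antisym])
  qed
  with comparable show ?thesis by blast
qed

text \<open>Induction along a zigzag of comparabilities starting at \<open>z\<close>: as long as the
  current point is still \<open>z\<close>, the next one is comparable with \<open>z\<close> itself
  and so cannot leave it.\<close>

lemma subtraction_zero_isolated:
  assumes diag: "\<And>x. t \<cdot> x \<cdot> x = z"
    and zero: "\<And>x. t \<cdot> x \<cdot> z = x"
    and "equivclp le z x"
  shows "x = z"
  using \<open>equivclp le z x\<close>
proof (induction rule: equivclp_induct)
  case base
  show ?case ..
next
  case (step y w)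
  then have "t \<cdot> w \<cdot> z = z"
    using subtraction_comparable_eq[of t z w z, OF diag] by blast
  then show ?case by (simp add: zero)
qed

end

context connected_ordered_lambda_model
begin

lemma equivclp_le: "equivclp le x y"
proof -
  let ?R = "{(x, y). equivclp le x y}"
  have "?R `` {x} = ?R `` {y}"
    using connected quotientI[of _ UNIV ?R] by (metis UNIV_I is_singletonE singletonD)
  then have "y \<in> ?R `` {x}" by simp
  then show ?thesis by simp
qed

end

theorem theorem3p3:
  "\<not> (\<exists>(app :: 'a \<Rightarrow> 'a \<Rightarrow> 'a) K S le.
        connected_ordered_lambda_model app K S le \<and>
        (\<exists>a b :: 'a. a \<noteq> b) \<and>
        combinatory_algebra.satisfies_eq app K S
          (App (App Theta_tm (Var ''x'')) (Var ''x'')) Omega_tm \<and>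
        combinatory_algebra.satisfies_eq app K S
          (App (App Theta_tm (Var ''x'')) Omega_tm) (Var ''x''))"
proof (rule notI, elim exE conjE)
  fix app :: "'a \<Rightarrow> 'a \<Rightarrow> 'a" and K S le and a b :: 'a
  assume model: "connected_ordered_lambda_model app K S le"
    and "a \<noteq> b"
    and diag_eq: "combinatory_algebra.satisfies_eq app K S
          (App (App Theta_tm (Var ''x'')) (Var ''x'')) Omega_tm"
    and zero_eq: "combinatory_algebra.satisfies_eq app K S
          (App (App Theta_tm (Var ''x'')) Omega_tm) (Var ''x'')"
  interpret connected_ordered_lambda_model app K S le by (rule model)
  \<comment> \<open>The environment is an arbitrary choice: both terms are closed, so their values
    are the same in every environment.\<close>
  define t where "t = interp (\<lambda>_. K) Theta_tm"
  define z where "z = interp (\<lambda>_. K) Omega_tm"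
  have t: "ceval \<rho> (translate Theta_tm) = t" for \<rho>
    by (simp add: t_def interp_def Theta_tm_def B_tm_def C_tm_def)
  have z: "ceval \<rho> (translate Omega_tm) = z" for \<rho>
    by (simp add: z_def interp_def Omega_tm_def)
  have diag: "app (app t x) x = z" for x
    using diag_eq[unfolded satisfies_eq_def, rule_format, of "\<lambda>_. x"]
    by (simp add: interp_def t z)
  have zero: "app (app t x) z = x" for x
    using zero_eq[unfolded satisfies_eq_def, rule_format, of "\<lambda>_. x"]
    by (simp add: interp_def t z)
  \<comment> \<open>Connectedness links every element to the isolated point \<open>z\<close>, which
    collapses the model.\<close>
  have "x = z" for x
    using diag zero equivclp_le by (rule subtraction_zero_isolated)
  from this[of a] this[of b] have "a = b" by simp
  with \<open>a \<noteq> b\<close> show False ..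
qed

end
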